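(* Let $A\in\mathbb{R}_+^{\infty\times\infty}$ be irreducible. If $\lambda\in\sigma_p(A)$ and $A\otimes x=\lambda x$ with $x\in\ell^\infty_+$, $x\neq0$, then $x>0$ and $\lambda\in[\mu(A),r(A)]$.
   Context: $\mathbb{R}_+^{\infty\times\infty}$ is the set of infinite matrices $A=(a_{ij})_{i,j\in\mathbb{N}}$ with non-negative real entries and $\|A\|:=\sup\{a_{ij}:i,j\in\mathbb{N}\}<\infty$, where $\mathbb{N}=\{1,2,\dots\}$. $\ell^\infty_+$ is the set of bounded non-negative sequences; $x>0$ (strictly positive) means $x_i>0$ for all $i\in\mathbb{N}$. In max algebra, $(A\otimes B)_{ij}=\sup_{k}a_{ik}b_{kj}$, $(A\otimes x)_i=\sup_j a_{ij}x_j$, and $A^k_\otimes$ is the $k$-th power of $A$ for $\otimes$. The max-algebra spectral radius is $r(A)=\lim_{k\to\infty}\|A^k_\otimes\|^{1/k}=\inf_k\|A^k_\otimes\|^{1/k}$ (the limit exists). The point spectrum $\sigma_p(A)$ is the set of all $t\ge0$ such that $A\otimes x=tx$ for some $x\in\ell^\infty_+$, $x\ne0$. $A$ is irreducible if the directed graph with vertex set $\mathbb{N}$ and an edge from $i$ to $j$ whenever $a_{ij}>0$ is strongly connected (for all $i\ne j$ there is a path from $i$ to $j$); equivalently, for each $(i,j)\in\mathbb{N}\times\mathbb{N}$ there is $k$ with $(A^k_\otimes)_{ij}>0$. For $i_0,\dots,i_k\in\mathbb{N}$ put $A(i_k,\dots,i_0)=\prod_{t=0}^{k-1}a_{i_{t+1}i_t}$,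 and define $\mu(A)=\sup\{A(i_1,i_k,\dots,i_2,i_1)^{1/k}:k\in\mathbb{N},\ i_1,\dots,i_k\in\mathbb{N}\}$. *)

theory Defs
  imports "HOL-Analysis.Analysis"
begin

(* The index set {1,2,...} serves only as a countably infinite set of labels, so it is
   represented by the whole type nat.  Exponents and path lengths, where the value matters,
   are explicitly required to be positive. *)
type_synonym inf_matrix = "nat \<Rightarrow> nat \<Rightarrow> real"

definition bounded_nonneg_matrices :: "inf_matrix set" where
  "bounded_nonneg_matrices = {A. (\<forall>i j. 0 \<le> A i j) \<and> bdd_above (range (\<lambda>(i, j). A i j))}"

definition matrix_sup_norm :: "inf_matrix \<Rightarrow> real" where
  "matrix_sup_norm A = (SUP (i, j). A i j)"

definition l_infinity_nonneg :: "(nat \<Rightarrow> real) set" where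
  "l_infinity_nonneg = {x. (\<forall>i. 0 \<le> x i) \<and> bdd_above (range x)}"

(* Real suprema are meaningful only for sets bounded above; this is always the case below,
   since the operations are applied to bounded non-negative matrices and sequences. *)
definition max_times :: "inf_matrix \<Rightarrow> inf_matrix \<Rightarrow> inf_matrix" where
  "max_times A B = (\<lambda>i j. SUP k. A i k * B k j)"

definition max_apply :: "inf_matrix \<Rightarrow> (nat \<Rightarrow> real) \<Rightarrow> nat \<Rightarrow> real" where
  "max_apply A x = (\<lambda>i. SUP j. A i j * x j)"

primrec max_power :: "inf_matrix \<Rightarrow> nat \<Rightarrow> inf_matrix" where
  "max_power A 0 = (\<lambda>i j. if i = j then 1 else 0)"
| "max_power A (Suc k) = max_times (max_power A k) A"

definition max_spectral_radius :: "inf_matrix \<Rightarrow> real" where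
  "max_spectral_radius A = lim (\<lambda>k. root k (matrix_sup_norm (max_power A k)))"

definition max_point_spectrum :: "inf_matrix \<Rightarrow> real set" where
  "max_point_spectrum A =
    {t. 0 \<le> t \<and> (\<exists>x \<in> l_infinity_nonneg. x \<noteq> (\<lambda>i. 0) \<and> max_apply A x = (\<lambda>i. t * x i))}"

definition irreducible_matrix :: "inf_matrix \<Rightarrow> bool" where
  "irreducible_matrix A \<longleftrightarrow> (\<forall>i j. i \<noteq> j \<longrightarrow> (i, j) \<in> {(u, v). 0 < A u v}\<^sup>+)"

(* A(i_k, ..., i_0), the indices i_0, ..., i_k being the first k + 1 values of the function i *)
definition path_weight :: "inf_matrix \<Rightarrow> nat \<Rightarrow> (nat \<Rightarrow> nat) \<Rightarrow> real" where
  "path_weight A k i = (\<Prod>t<k. A (i (Suc t)) (i t))"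

(* A closed path (i_1, i_k, ..., i_2, i_1) is a sequence i 0, ..., i k with i k = i 0,
   where i t stands for i_(t+1). *)
definition max_cycle_mean :: "inf_matrix \<Rightarrow> real" where
  "max_cycle_mean A = Sup {root k (path_weight A k i) | k i. 0 < k \<and> i k = i 0}"

end

theory Submission
  imports Defs
begin

text \<open>
  Positivity propagates from \<open>j\<close> to \<open>i\<close> along an edge because \<open>A i j * x j \<le> lam * x i\<close>; multiplying
  these inequalities around a closed path of length \<open>k\<close> bounds its weight by \<open>lam ^ k\<close>.
  Iterating the eigenvalue equation gives \<open>lam ^ k * x i = (SUP j. max_power A k i j * x j)\<close>, which is
  at most the norm of the \<open>k\<close>-th power times \<open>SUP j. x j\<close>; taking the supremum over \<open>i\<close> and
  cancelling \<open>SUP j. x j\<close> shows that \<open>lam\<close> is at most every \<open>k\<close>-th root whose limit is the spectral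
  radius. That limit exists by Fekete's lemma.
\<close>

section \<open>Fekete's lemma\<close>

lemma subadditive_mult_le:
  fixes c :: "nat \<Rightarrow> real"
  assumes "\<And>m n. c (m + n) \<le> c m + c n"
  shows "c (q * m + r) \<le> real q * c m + c r"
proof (induction q)
  case (Suc q)
  have "c (Suc q * m + r) \<le> c m + c (q * m + r)"
    using assms[of m "q * m + r"] by (simp add: add.assoc)
  with Suc show ?case by (simp add: algebra_simps)
qed simp

text \<open>The lower estimate is immediate from the infimum. For the upper one, division with
  remainder by an \<open>m\<close> with \<open>c m / m\<close> close to the infimum leaves an error
  that vanishes after dividing by \<open>n\<close>.\<close>

lemma fekete:
  fixes c :: "nat \<Rightarrow> real"
  assumes sub: "\<And>m n. c (m + n) \<le> c m + c n"
    and bdd: "bdd_below ((\<lambda>n. c n / n) ` {1..})"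
  shows "(\<lambda>n. c n / n) \<longlonglongrightarrow> (INF n\<in>{1..}. c n / n)"
proof (rule order_tendstoI)
  fix y assume y: "y < (INF n\<in>{1..}. c n / n)"
  have "y < c n / n" if "n \<ge> 1" for n
    using less_le_trans[OF y cINF_lower[OF bdd]] that by simp
  then show "\<forall>\<^sub>F n in sequentially. y < c n / n"
    unfolding eventually_sequentially by blast
next
  fix y assume "(INF n\<in>{1..}. c n / n) < y"
  then obtain m :: nat where m: "m \<ge> 1" "c m / m < y"
    using cINF_less_iff[OF _ bdd] by auto
  define s where "s = c m / m"
  \<comment> \<open>The largest excess of \<open>c r\<close> over the linear rate
    \<open>r * s\<close> among the possible remainders \<open>r < m\<close>; it does not depend on
    \<open>n\<close>.\<close>
  define M where "M = Max ((\<lambda>r. c r - r * s) ` {..<m})"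
  have bound: "c n / n \<le> s + M / n" if "n \<ge> 1" for n
  proof -
    have cm: "c m = m * s"
      using m(1) by (simp add: s_def)
    have "c (n mod m) - (n mod m) * s \<le> M"
      unfolding M_def using m(1) by (intro Max_ge) auto
    moreover have "c n \<le> real (n div m) * c m + c (n mod m)"
      using subadditive_mult_le[of c "n div m" m "n mod m", OF sub] by simp
    moreover have "real n = real (n div m) * real m + real (n mod m)"
      by (metis div_mult_mod_eq of_nat_add of_nat_mult)
    ultimately have "c n \<le> n * s + M"
      by (simp add: cm algebra_simps)
    then show ?thesis
      using that by (simp add: field_simps)
  qed
  have "(\<lambda>n. s + M / real n) \<longlonglongrightarrow> s + 0"
    by (intro tendsto_intros lim_const_over_n)
  then have "\<forall>\<^sub>F n in sequentially. s + M / real n < y"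
    using m(2) by (intro order_tendstoD) (auto simp: s_def)
  then show "\<forall>\<^sub>F n in sequentially. c n / n < y"
    using eventually_ge_at_top[of 1] by eventually_elim (use bound in force)
qed

text \<open>Logarithms turn submultiplicativity into subadditivity. The geometric lower bound makes
  them meaningful and bounds \<open>ln (a n) / n\<close> from below by \<open>ln l\<close>; powers
  of the eigenvalue will play this role.\<close>

lemma convergent_root_submultiplicative:
  fixes a :: "nat \<Rightarrow> real"
  assumes sub: "\<And>m n. a (m + n) \<le> a m * a n"
    and l: "l > 0" "\<And>n. l ^ n \<le> a n"
  shows "convergent (\<lambda>n. root n (a n))"
proof -
  have pos: "a n > 0" for n
    using l(2)[of n] zero_less_power[OF l(1), of n] by linarith
  have "ln (a (m + n)) \<le> ln (a m) + ln (a n)" for m n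
  proof -
    have "ln (a (m + n)) \<le> ln (a m * a n)"
      using sub pos by simp
    then show ?thesis
      using pos[of m] pos[of n] by (simp add: ln_mult)
  qed
  moreover have "ln l \<le> ln (a n) / n" if "n \<ge> 1" for n
  proof -
    have "ln (l ^ n) \<le> ln (a n)"
      using l pos by simp
    then show ?thesis
      using l(1) that by (simp add: ln_realpow field_simps)
  qed
  then have "bdd_below ((\<lambda>n. ln (a n) / n) ` {1..})"
    by (intro bdd_belowI2[where m = "ln l"]) simp
  ultimately have "(\<lambda>n. exp (ln (a n) / n)) \<longlonglongrightarrow> exp (INF n\<in>{1..}. ln (a n) / n)"
    by (intro tendsto_exp fekete)
  \<comment> \<open>At \<open>n = 0\<close> the two sides differ (1 and 0), so the identity is
    claimed only eventually.\<close>
  moreover have "\<forall>\<^sub>F n in sequentially. exp (ln (a n) / n) = root n (a n)"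
    using eventually_ge_at_top[of 1]
  proof eventually_elim
    case (elim n)
    then show ?case
      using pos[of n] by (simp add: root_powr_inverse powr_def)
  qed
  ultimately show ?thesis
    by (rule convergentI[OF Lim_transform_eventually])
qed

section \<open>Max-algebra powers\<close>

lemma bounded_nonneg_matricesD:
  assumes "A \<in> bounded_nonneg_matrices"
  shows "0 \<le> A i j" and "A i j \<le> matrix_sup_norm A"
proof -
  show "0 \<le> A i j"
    using assms by (simp add: bounded_nonneg_matrices_def)
  have "bdd_above (range (\<lambda>(i, j). A i j))"
    using assms by (simp add: bounded_nonneg_matrices_def)
  from cSUP_upper[OF _ this, of "(i, j)"] show "A i j \<le> matrix_sup_norm A"
    by (simp add: matrix_sup_norm_def)
qed

lemma matrix_sup_norm_nonneg:
  assumes "A \<in> bounded_nonneg_matrices"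
  shows "0 \<le> matrix_sup_norm A"
  using bounded_nonneg_matricesD[OF assms, of 0 0] by linarith

lemma matrix_sup_norm_le:
  assumes "\<And>i j. A i j \<le> c"
  shows "matrix_sup_norm A \<le> c"
  unfolding matrix_sup_norm_def using assms by (intro cSUP_least) auto

lemma bounded_nonneg_matricesI:
  assumes "\<And>i j. 0 \<le> A i j" and "\<And>i j. A i j \<le> c"
  shows "A \<in> bounded_nonneg_matrices"
  unfolding bounded_nonneg_matrices_def using assms by (auto intro!: bdd_aboveI2[where M = c])

lemma
  assumes "A \<in> bounded_nonneg_matrices" and "B \<in> bounded_nonneg_matrices"
  shows max_times_upper: "A i k * B k j \<le> max_times A B i j"
    and max_times_closed: "max_times A B \<in> bounded_nonneg_matrices"
proof -
  note A = bounded_nonneg_matricesD[OF assms(1)] and B = bounded_nonneg_matricesD[OF assms(2)]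
  have le: "A i k * B k j \<le> matrix_sup_norm A * matrix_sup_norm B" for i j k
    using A B by (intro mult_mono matrix_sup_norm_nonneg[OF assms(1)]) auto
  have upper: "A i k * B k j \<le> max_times A B i j" for i j k
    unfolding max_times_def using le by (intro cSUP_upper bdd_aboveI2) auto
  show "A i k * B k j \<le> max_times A B i j"
    by (rule upper)
  show "max_times A B \<in> bounded_nonneg_matrices"
  proof (rule bounded_nonneg_matricesI)
    show "0 \<le> max_times A B i j" for i j
      using order_trans[OF mult_nonneg_nonneg[OF A(1) B(1)] upper] by blast
    show "max_times A B i j \<le> matrix_sup_norm A * matrix_sup_norm B" for i j
      unfolding max_times_def by (intro cSUP_least le) auto
  qed
qed

lemma max_power_closed:
  assumes "A \<in> bounded_nonneg_matrices"
  shows "max_power A k \<in> bounded_nonneg_matrices"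
proof (induction k)
  case 0
  show ?case by (rule bounded_nonneg_matricesI[where c = 1]) auto
next
  case (Suc k)
  then show ?case using max_times_closed[OF _ assms] by simp
qed

text \<open>Bounding by the \<open>j\<close>-th column of the power makes the induction work without associativity
  of \<open>max_times\<close>.\<close>

lemma max_power_add_le:
  assumes A: "A \<in> bounded_nonneg_matrices" and "\<And>p. max_power A k p j \<le> c"
  shows "max_power A (m + k) i j \<le> matrix_sup_norm (max_power A m) * c"
proof -
  let ?N = "matrix_sup_norm (max_power A m)"
  have N: "0 \<le> ?N"
    by (intro matrix_sup_norm_nonneg max_power_closed A)
  show ?thesis
    using assms(2)
  proof (induction k arbitrary: j c)
    case 0
    have "max_power A m i j \<le> ?N * 1"
      using bounded_nonneg_matricesD(2)[OF max_power_closed[OF A]] by simp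
    \<comment> \<open>The diagonal entry of the identity matrix forces
      \<open>1 \<le> c\<close>.\<close>
    also have "\<dots> \<le> ?N * c"
      using 0[of j] N by (intro mult_left_mono) auto
    finally show ?case by simp
  next
    case (Suc k)
    have "max_power A (m + k) i l * A l j \<le> ?N * c" for l
    proof (cases "A l j = 0")
      case True
      have "0 \<le> c"
        using bounded_nonneg_matricesD(1)[OF max_power_closed[OF A], of "Suc k"] Suc.prems[of 0]
        by (rule order_trans)
      with True N show ?thesis by simp
    next
      case False
      then have pos: "A l j > 0"
        using bounded_nonneg_matricesD(1)[OF A, of l j] by simp
      have "max_power A k p l * A l j \<le> c" for p
        using max_times_upper[OF max_power_closed[OF A] A, of k p l j] Suc.prems[of p] by simp
      \<comment> \<open>Dividing by the last edge turns a bound on column \<open>j\<close> into one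
        on column \<open>l\<close> of the lower power; hence the induction generalises over both
        \<open>j\<close> and \<open>c\<close>.\<close>
      then have "max_power A k p l \<le> c / A l j" for p
        using pos by (simp add: field_simps)
      from Suc.IH[OF this] show ?thesis
        using pos by (simp add: field_simps)
    qed
    then show ?case
      by (simp add: max_times_def cSUP_least)
  qed
qed

lemma matrix_sup_norm_max_power_add:
  assumes "A \<in> bounded_nonneg_matrices"
  shows "matrix_sup_norm (max_power A (m + k))
    \<le> matrix_sup_norm (max_power A m) * matrix_sup_norm (max_power A k)"
  by (intro matrix_sup_norm_le max_power_add_le assms
      bounded_nonneg_matricesD(2) max_power_closed)

section \<open>Eigenvectors\<close>

lemma max_apply_upper:
  assumes "A \<in> bounded_nonneg_matrices" and "x \<in> l_infinity_nonneg"
  shows "A i j * x j \<le> max_apply A x i"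
proof -
  obtain X where "\<And>j. x j \<le> X"
    using assms(2) by (auto simp: l_infinity_nonneg_def bdd_above_def)
  then have "A i j * x j \<le> matrix_sup_norm A * X" for j
    using assms(2) bounded_nonneg_matricesD[OF assms(1)] matrix_sup_norm_nonneg[OF assms(1)]
    by (intro mult_mono) (auto simp: l_infinity_nonneg_def)
  then show ?thesis
    unfolding max_apply_def by (intro cSUP_upper bdd_aboveI2) auto
qed

locale max_eigenvector =
  fixes A :: inf_matrix and x :: "nat \<Rightarrow> real" and lam :: real
  assumes A: "A \<in> bounded_nonneg_matrices"
    and x: "x \<in> l_infinity_nonneg"
    and eigen: "max_apply A x = (\<lambda>i. lam * x i)"
begin

lemma x_nonneg: "0 \<le> x i"
  using x by (simp add: l_infinity_nonneg_def)

lemma edge_le: "A i j * x j \<le> lam * x i"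
  using max_apply_upper[OF A x, of i j] by (simp add: eigen)

lemma edge_pos:
  assumes "0 < A i j" and "0 < x j" and "0 \<le> lam"
  shows "0 < lam" and "0 < x i"
proof -
  have "0 < lam * x i"
    using edge_le[of i j] mult_pos_pos[OF assms(1,2)] by linarith
  then show "0 < lam" and "0 < x i"
    using assms(3) by (auto simp: zero_less_mult_iff)
qed

lemma trancl_pos:
  assumes "(i, j) \<in> {(u, v). 0 < A u v}\<^sup>+" and "0 < x j" and "0 \<le> lam"
  shows "0 < lam \<and> 0 < x i"
  using assms(1)
proof (induction rule: converse_trancl_induct)
  case (base y)
  then show ?case using edge_pos assms(2,3) by auto
next
  case (step y z)
  then show ?case using edge_pos[of y z] assms(3) by auto
qed

text \<open>Stated for open paths so that induction on the length applies; for a closed path the two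
  equal positive entries of \<open>x\<close> cancel.\<close>

lemma path_weight_le:
  assumes "0 \<le> lam"
  shows "path_weight A k i * x (i 0) \<le> lam ^ k * x (i k)"
proof (induction k)
  case 0
  show ?case by (simp add: path_weight_def)
next
  case (Suc k)
  have "path_weight A (Suc k) i * x (i 0)
      = A (i (Suc k)) (i k) * (path_weight A k i * x (i 0))"
    by (simp add: path_weight_def)
  also have "\<dots> \<le> A (i (Suc k)) (i k) * (lam ^ k * x (i k))"
    by (intro mult_left_mono Suc bounded_nonneg_matricesD[OF A])
  also have "\<dots> = lam ^ k * (A (i (Suc k)) (i k) * x (i k))"
    by simp
  also have "\<dots> \<le> lam ^ k * (lam * x (i (Suc k)))"
    by (intro mult_left_mono edge_le zero_le_power assms)
  finally show ?case by (simp add: algebra_simps)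
qed

text \<open>Working with an arbitrary upper bound \<open>c\<close> avoids interchanging suprema: the
  eigenvalue equation trades one factor of \<open>A\<close> for one factor \<open>lam\<close>, so
  the induction hypothesis is used with \<open>c / lam\<close>.\<close>

lemma power_eigen_le:
  assumes "0 < lam" and "\<And>j. max_power A k i j * x j \<le> c"
  shows "lam ^ k * x i \<le> c"
  using assms(2)
proof (induction k arbitrary: c)
  case 0
  from 0[of i] show ?case by simp
next
  case (Suc k)
  note P = bounded_nonneg_matricesD(1)[OF max_power_closed[OF A]]
  have "max_power A k i j * x j \<le> c / lam" for j
  proof (cases "max_power A k i j = 0")
    case True
    have "0 \<le> max_power A (Suc k) i j * x j"
      by (intro mult_nonneg_nonneg P x_nonneg)
    with Suc.prems[of j] True assms(1) show ?thesis by simp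
  next
    case False
    then have pos: "0 < max_power A k i j"
      using P[of k i j] by simp
    have "max_power A k i j * A j l * x l \<le> c" for l
    proof -
      have "max_power A k i j * A j l * x l \<le> max_power A (Suc k) i l * x l"
        using max_times_upper[OF max_power_closed[OF A] A]
        by (intro mult_right_mono x_nonneg) simp
      with Suc.prems[of l] show ?thesis by linarith
    qed
    then have "A j l * x l \<le> c / max_power A k i j" for l
      using pos by (simp add: field_simps)
    \<comment> \<open>With the positive entry moved to the right, the bound is uniform in
      \<open>l\<close>, so the supremum can be taken and replaced by
      \<open>lam * x j\<close>.\<close>
    then have "max_apply A x j \<le> c / max_power A k i j"
      unfolding max_apply_def by (intro cSUP_least) auto
    then show ?thesis
      using pos assms(1) by (simp add: eigen field_simps)
  qed
  from Suc.IH[OF this] show ?case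
    using assms(1) by (simp add: field_simps)
qed

lemma power_le_norm_max_power:
  assumes "0 < lam" and "0 < x i"
  shows "lam ^ k \<le> matrix_sup_norm (max_power A k)"
proof -
  let ?N = "matrix_sup_norm (max_power A k)" and ?X = "SUP i. x i"
  have le_X: "x j \<le> ?X" for j
    using x by (intro cSUP_upper) (auto simp: l_infinity_nonneg_def)
  have "max_power A k p j * x j \<le> ?N * ?X" for p j
    using le_X x_nonneg bounded_nonneg_matricesD(2)[OF max_power_closed[OF A]]
    by (intro mult_mono matrix_sup_norm_nonneg max_power_closed A) auto
  then have "lam ^ k * x p \<le> ?N * ?X" for p
    using power_eigen_le[OF assms(1)] by blast
  then have "x p \<le> ?N * ?X / lam ^ k" for p
    using assms(1) by (simp add: field_simps)
  then have "?X \<le> ?N * ?X / lam ^ k"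
    by (intro cSUP_least) auto
  moreover have "0 < ?X"
    using le_X[of i] assms(2) by linarith
  ultimately show ?thesis
    using assms(1) by (simp add: field_simps)
qed

end

theorem proposition3p12:
  fixes A :: inf_matrix and x :: "nat \<Rightarrow> real" and lam :: real
  assumes "A \<in> bounded_nonneg_matrices"
    and "irreducible_matrix A"
    and "lam \<in> max_point_spectrum A"
    and "x \<in> l_infinity_nonneg"
    and "x \<noteq> (\<lambda>i. 0)"
    and "max_apply A x = (\<lambda>i. lam * x i)"
  shows "(\<forall>i. 0 < x i) \<and> lam \<in> {max_cycle_mean A..max_spectral_radius A}"
proof -
  interpret max_eigenvector A x lam
    using assms by unfold_locales
  have lam_nonneg: "0 \<le> lam"
    using assms(3) by (simp add: max_point_spectrum_def)
  obtain j where j: "0 < x j"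
    using assms(5) x_nonneg by (metis less_eq_real_def)
  \<comment> \<open>Irreducibility provides paths only between distinct indices, so \<open>j\<close>
    itself is excluded here.\<close>
  have pos: "0 < lam \<and> 0 < x i" if "i \<noteq> j" for i
    using assms(2) that trancl_pos[OF _ j lam_nonneg] unfolding irreducible_matrix_def by blast
  \<comment> \<open>Any index other than \<open>j\<close> serves: the path from it to
    \<open>j\<close> has at least one edge, which forces \<open>lam\<close> to be positive.\<close>
  have lam_pos: "0 < lam"
    using pos[of "Suc j"] by simp
  have x_pos: "0 < x i" for i
    using pos j by (cases "i = j") auto
  have "root k (path_weight A k i) \<le> lam" if "0 < k" and "i k = i 0" for k i
  proof -
    have "path_weight A k i \<le> lam ^ k"
      using path_weight_le[OF lam_nonneg, of k i] x_pos[of "i 0"] that(2) by simp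
    then have "root k (path_weight A k i) \<le> root k (lam ^ k)"
      using that(1) by simp
    then show ?thesis
      using that(1) lam_nonneg by (simp add: real_root_power_cancel)
  qed
  moreover have "{root k (path_weight A k i) | k i. 0 < k \<and> i k = i 0} \<noteq> {}"
    by auto
  ultimately have lower: "max_cycle_mean A \<le> lam"
    unfolding max_cycle_mean_def by (intro cSup_least) auto
  let ?n = "\<lambda>k. matrix_sup_norm (max_power A k)"
  have pow_le: "lam ^ k \<le> ?n k" for k
    by (rule power_le_norm_max_power[OF lam_pos j])
  have "(\<lambda>k. root k (?n k)) \<longlonglongrightarrow> max_spectral_radius A"
    unfolding max_spectral_radius_def
    using convergent_root_submultiplicative[OF matrix_sup_norm_max_power_add[OF A] lam_pos pow_le]
    by (simp add: convergent_LIMSEQ_iff)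
  \<comment> \<open>The bound starts at \<open>k = 1\<close> because \<open>root 0\<close> is
    identically zero.\<close>
  moreover have "lam \<le> root k (?n k)" if "k \<ge> 1" for k
  proof -
    have "root k (lam ^ k) \<le> root k (?n k)"
      using pow_le that by simp
    then show ?thesis
      using that lam_nonneg by (simp add: real_root_power_cancel)
  qed
  ultimately have "lam \<le> max_spectral_radius A"
    by (intro LIMSEQ_le_const) auto
  with lower x_pos show ?thesis by simp
qed

end
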